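(* Let $0<t<1$ and let $f_t:\mathbb{R}^+\to\mathbb{R}^+$ be $$f_t(x)=t(1-t)\frac{(x-1)^2}{(x^t-1)(x^{1-t}-1)} \quad (x\neq 1),\qquad f_t(1)=1.$$ Then for every $n\ge 1$ and every positive definite $D\in\mathbf{M}_n$, the mapping $\beta=(\mathbb{J}_D^{f_t})^{-1}:\mathbf{M}_n\to\mathbf{M}_n$ is completely positive.
   Context: $\mathbf{M}_n$ is the algebra of $n\times n$ complex matrices and $\mathbb{R}^+=(0,\infty)$. For a function $f:\mathbb{R}^+\to\mathbb{R}^+$ put $m_f(x,y)=x f(y/x)$ for $x,y>0$. For a positive definite $D\in\mathbf{M}_n$ let $\mathbb{L}_D(X)=DX$ and $\mathbb{R}_D(X)=XD$ (commuting positive operators on $\mathbf{M}_n$ with the Hilbert–Schmidt inner product), and define the linear operator $\mathbb{J}_D^f=f(\mathbb{L}_D\mathbb{R}_D^{-1})\mathbb{R}_D:\mathbf{M}_n\to\mathbf{M}_n$. If $f$ satisfies $t f(t^{-1})=f(t)$ (as the function in the claim does) and $D=\mathrm{Diag}(\lambda_1,\dots,\lambda_n)$, then $(\mathbb{J}_D^f A)_{ij}=A_{ij}\,m_f(\lambda_i,\lambda_j)$, so that $((\mathbb{J}_D^f)^{-1}A)_{ij}=A_{ij}/m_f(\lambda_i,\lambda_j)$. *)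

theory Defs
  imports "Jordan_Normal_Form.Schur_Decomposition"
begin

text \<open>The order on \<^typ>\<open>complex\<close> is the one of \<^theory>\<open>HOL-Library.Complex_Order\<close>: \<open>0 \<le> z\<close> says
  that \<open>z\<close> is real and nonnegative. Over the complex numbers the two conditions below
  therefore force the matrix to be Hermitian.\<close>

definition pos_semidef :: "nat \<Rightarrow> complex mat \<Rightarrow> bool" where
  "pos_semidef n A \<longleftrightarrow>
     A \<in> carrier_mat n n \<and> (\<forall>v \<in> carrier_vec n. 0 \<le> (A *\<^sub>v v) \<bullet>c v)"

definition pos_def :: "nat \<Rightarrow> complex mat \<Rightarrow> bool" where
  "pos_def n A \<longleftrightarrow>
     A \<in> carrier_mat n n \<and> (\<forall>v \<in> carrier_vec n. v \<noteq> 0\<^sub>v n \<longrightarrow> 0 < (A *\<^sub>v v) \<bullet>c v)"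

text \<open>Operators on the space \<open>carrier_mat n n\<close> of complex \<open>n \<times> n\<close> matrices are functions
  \<^typ>\<open>complex mat \<Rightarrow> complex mat\<close>, of which only the values on \<open>carrier_mat n n\<close> matter.\<close>

definition linear_op :: "nat \<Rightarrow> (complex mat \<Rightarrow> complex mat) \<Rightarrow> bool" where
  "linear_op n T \<longleftrightarrow>
     (\<forall>X \<in> carrier_mat n n. T X \<in> carrier_mat n n) \<and>
     (\<forall>X \<in> carrier_mat n n. \<forall>Y \<in> carrier_mat n n. T (X + Y) = T X + T Y) \<and>
     (\<forall>X \<in> carrier_mat n n. \<forall>c. T (c \<cdot>\<^sub>m X) = c \<cdot>\<^sub>m T X)"

definition inv_op :: "nat \<Rightarrow> (complex mat \<Rightarrow> complex mat) \<Rightarrow> complex mat \<Rightarrow> complex mat" where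
  "inv_op n T = inv_into (carrier_mat n n) T"

definition left_mult :: "complex mat \<Rightarrow> complex mat \<Rightarrow> complex mat" where
  "left_mult D X = D * X"

definition right_mult :: "complex mat \<Rightarrow> complex mat \<Rightarrow> complex mat" where
  "right_mult D X = X * D"

text \<open>The Hilbert--Schmidt inner product: the trace of \<open>A\<close>-adjoint times \<open>B\<close>.\<close>

definition hs_inner :: "complex mat \<Rightarrow> complex mat \<Rightarrow> complex" where
  "hs_inner A B = sum_list (diag_mat (mat_adjoint A * B))"

definition eigenspace_op ::
  "nat \<Rightarrow> (complex mat \<Rightarrow> complex mat) \<Rightarrow> real \<Rightarrow> complex mat set" where
  "eigenspace_op n T r = {X \<in> carrier_mat n n. T X = complex_of_real r \<cdot>\<^sub>m X}"

definition real_spectrum_op :: "nat \<Rightarrow> (complex mat \<Rightarrow> complex mat) \<Rightarrow> real set" where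
  "real_spectrum_op n T = {r. \<exists>X \<in> eigenspace_op n T r. X \<noteq> 0\<^sub>m n n}"

definition orth_proj :: "nat \<Rightarrow> complex mat set \<Rightarrow> complex mat \<Rightarrow> complex mat" where
  "orth_proj n E X = (THE Y. Y \<in> E \<and> (\<forall>Z \<in> E. hs_inner Z (X - Y) = 0))"

text \<open>Functional calculus for an operator \<open>T\<close> that is self-adjoint with respect to
  \<^const>\<open>hs_inner\<close>: the sum of \<open>f r\<close> times the spectral projection of \<open>r\<close>, over all
  eigenvalues \<open>r\<close> of \<open>T\<close> (which are then real). The sum of matrices is taken entrywise, as
  the type of matrices of all dimensions is not an additive monoid.\<close>

definition fun_calc ::
  "nat \<Rightarrow> (real \<Rightarrow> real) \<Rightarrow> (complex mat \<Rightarrow> complex mat) \<Rightarrow> complex mat \<Rightarrow> complex mat" where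
  "fun_calc n f T X = mat n n (\<lambda>(i, j).
     \<Sum>r \<in> real_spectrum_op n T.
       complex_of_real (f r) * orth_proj n (eigenspace_op n T r) X $$ (i, j))"

definition J_op :: "nat \<Rightarrow> (real \<Rightarrow> real) \<Rightarrow> complex mat \<Rightarrow> complex mat \<Rightarrow> complex mat" where
  "J_op n f D =
     fun_calc n f (left_mult D \<circ> inv_op n (right_mult D)) \<circ> right_mult D"

text \<open>An \<open>m \<times> m\<close> block matrix with \<open>n \<times> n\<close> blocks is an \<open>(m * n) \<times> (m * n)\<close> matrix whose
  entry \<open>(a, b)\<close> in block \<open>(k, l)\<close> is the entry \<open>(k * n + a, l * n + b)\<close>. The ampliation
  of \<open>T\<close>, the tensor product of the identity on \<open>m \<times> m\<close> matrices with \<open>T\<close>, applies \<open>T\<close>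
  to every block.\<close>

definition block :: "nat \<Rightarrow> complex mat \<Rightarrow> nat \<Rightarrow> nat \<Rightarrow> complex mat" where
  "block n M k l = mat n n (\<lambda>(a, b). M $$ (k * n + a, l * n + b))"

definition ampliation ::
  "nat \<Rightarrow> nat \<Rightarrow> (complex mat \<Rightarrow> complex mat) \<Rightarrow> complex mat \<Rightarrow> complex mat" where
  "ampliation m n T M = mat (m * n) (m * n) (\<lambda>(i, j).
     T (block n M (i div n) (j div n)) $$ (i mod n, j mod n))"

definition completely_positive :: "nat \<Rightarrow> (complex mat \<Rightarrow> complex mat) \<Rightarrow> bool" where
  "completely_positive n T \<longleftrightarrow>
     linear_op n T \<and>
     (\<forall>m M. pos_semidef (m * n) M \<longrightarrow> pos_semidef (m * n) (ampliation m n T M))"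

definition f_t :: "real \<Rightarrow> real \<Rightarrow> real" where
  "f_t t x = (if x = 1 then 1
     else t * (1 - t) * (x - 1)\<^sup>2 / ((x powr t - 1) * (x powr (1 - t) - 1)))"

end

theory Submission
  imports "HOL-Analysis.Equivalence_Lebesgue_Henstock_Integration" Defs
begin

text \<open>
  Diagonalize \<open>D\<close> by a unitary \<open>U\<close>, with eigenvalues \<open>d\<^sub>i > 0\<close>. Left and right multiplication by
  \<open>D\<close> multiply the \<open>(i, j)\<close> coordinate of a matrix with respect to the eigenbasis by \<open>d\<^sub>i\<close> and by
  \<open>d\<^sub>j\<close>, so every operator built from them by functional calculus is a Schur multiplier in that
  basis; \<open>J_op n f D\<close> has the symbol \<open>f (d\<^sub>i / d\<^sub>j) * d\<^sub>j\<close> (\<open>J_op_multiplier\<close>). The symbol has no zeros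
  for \<open>f = f_t t\<close>, so the operator is bijective, and its inverse is the Schur multiplier with the
  reciprocal symbol (\<open>multiplier_inverse\<close>).

  Write \<open>L\<^sub>a(x, y) = (x\<^sup>a - y\<^sup>a) / (x - y)\<close> for the divided difference of the power function. The
  factorization behind the theorem is (\<open>f_t_reciprocal\<close>)
    \[ 1 / (y f_t(x / y)) = L_t(x, y) L_{1-t}(x, y) / (t (1 - t)). \]
  For \<open>0 < a < 1\<close> the kernel \<open>L\<^sub>a\<close> is positive semidefinite because the integral representation
  of \<open>x\<^sup>a\<close>, after the substitution of \<open>exp s\<close> for the integration variable, turns into
    \[ C L_a(x, y) = \int \frac{e^{(a+1) s}}{(x + e^s) (y + e^s)} \, ds, \]
  with \<open>C > 0\<close>, where for each \<open>s\<close> the integrand is a positive multiple of \<open>g(x) g(y)\<close>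
  (\<open>divdiff_powr_integral\<close>). The Schur product of such a kernel with a positive semidefinite one can
  therefore be computed under the integral, where it is only a rescaling of the test vector
  (\<open>psd_kernel_schur_divdiff_powr\<close>). Applied twice, this shows that the reciprocal symbol maps
  positive semidefinite kernels to positive semidefinite kernels by Schur product.

  Such a symbol gives a completely positive operator (\<open>multiplier_completely_positive\<close>): the
  quadratic form of the ampliation of a Schur multiplier to a block matrix is the sum of all entries
  of the Schur product of the symbol with a kernel that inherits positivity from the block matrix.
\<close>

section \<open>Divided differences of power functions\<close>

text \<open>
  The value on the diagonal is the derivative, which makes the kernel continuous. Eigenvalues of
  \<open>D\<close> may coincide even for different indices, so the diagonal value matters off the diagonal of
  the symbol as well.
\<close>

definition divdiff_powr :: "real \<Rightarrow> real \<Rightarrow> real \<Rightarrow> real" where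
  "divdiff_powr t x y =
     (if x = y then t * x powr (t - 1) else (x powr t - y powr t) / (x - y))"

text \<open>
  The density of the integral representation of \<open>divdiff_powr\<close>. It comes from
  \<open>\<lambda> powr t / ((x + \<lambda>) * (y + \<lambda>))\<close> on the half-line by \<open>\<lambda> = exp s\<close>; the exponential coordinate makes
  all integrands smooth on the whole line and turns scaling of \<open>\<lambda>\<close> into translation.
\<close>

definition powr_density :: "real \<Rightarrow> real \<Rightarrow> real \<Rightarrow> real \<Rightarrow> real" where
  "powr_density t x y s = exp ((t + 1) * s) / ((x + exp s) * (y + exp s))"

lemma has_bochner_integral_mono:
  fixes f g :: "'a \<Rightarrow> real"
  assumes "has_bochner_integral M f I" "has_bochner_integral M g J" "\<And>x. f x \<le> g x"
  shows "I \<le> J"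
  using assms integral_mono[of M f g] by (auto simp: has_bochner_integral_iff)

text \<open>
  The integrand decays like \<open>exp (t * s)\<close> at minus infinity and like \<open>exp (- (1 - t) * s)\<close> at plus
  infinity; both exponents \<open>t\<close> and \<open>1 - t\<close> are positive.
\<close>

lemma integrable_exp_div_one_plus_exp:
  fixes t :: real
  assumes "0 < t" "t < 1"
  shows "integrable lborel (\<lambda>s. exp (t * s) / (1 + exp s))"
proof -
  have half_line: "integrable lborel (\<lambda>s. indicator {0..} s * exp (- a * s) :: real)"
    if "0 < a" for a :: real
  proof -
    have "(\<lambda>s. exp (- a * s)) absolutely_integrable_on {0..}"
      by (intro nonnegative_absolutely_integrable_1 integrable_on_exp_minus_to_infinity that) auto
    then show ?thesis
      by (simp add: set_integrable_def integrable_completion)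
  qed
  have left: "integrable lborel (\<lambda>s. indicator {0..} (- s) * exp (t * s) :: real)"
    using lborel_integrable_real_affine[OF half_line[OF assms(1)], of "-1" 0] by simp
  have right: "integrable lborel (\<lambda>s. indicator {0..} s * exp (- (1 - t) * s) :: real)"
    using half_line[of "1 - t"] assms by simp
  show ?thesis
  proof (rule Bochner_Integration.integrable_bound[OF Bochner_Integration.integrable_add[OF left right]])
    show "(\<lambda>s. exp (t * s) / (1 + exp s)) \<in> borel_measurable lborel"
      by measurable
    show "AE s in lborel. norm (exp (t * s) / (1 + exp s)) \<le>
      norm (indicator {0..} (- s) * exp (t * s) + indicator {0..} s * exp (- (1 - t) * s) :: real)"
    proof (intro AE_I2)
      fix s :: real
      have "exp (t * s) / (1 + exp s) \<le> exp (t * s)"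
        by (simp add: divide_le_eq add_pos_pos)
      moreover have "exp (t * s) / (1 + exp s) \<le> exp (t * s) / exp s"
        by (intro divide_left_mono) (auto simp: add_pos_pos)
      moreover have "exp (t * s) / exp s = exp (- (1 - t) * s)"
        by (simp add: exp_diff[symmetric] algebra_simps)
      ultimately show "norm (exp (t * s) / (1 + exp s)) \<le>
          norm (indicator {0..} (- s) * exp (t * s) + indicator {0..} s * exp (- (1 - t) * s) :: real)"
        by (auto simp: indicator_def add_pos_pos)
    qed
  qed
qed

text \<open>
  The power of \<open>x\<close> appears without evaluating the integral: the translation of \<open>s\<close> by \<open>ln x\<close>
  pulls the factor \<open>x powr t\<close> out of the integrand and leaves the integral for \<open>x = 1\<close>.
\<close>

lemma powr_integral_representation:
  fixes t x :: real
  assumes "0 < t" "t < 1" "0 < x"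
  shows "has_bochner_integral lborel (\<lambda>s. exp (t * s) * x / (x + exp s))
    (x powr t * (\<integral>s. exp (t * s) / (1 + exp s) \<partial>lborel))"
proof -
  let ?C = "\<integral>s. exp (t * s) / (1 + exp s) \<partial>lborel"
  have shift: "exp (t * (ln x + s)) * x / (x + exp (ln x + s)) =
      x powr t * (exp (t * s) / (1 + exp s))" for s
  proof -
    have "exp (t * (ln x + s)) = x powr t * exp (t * s)"
      using assms by (simp add: powr_def exp_add[symmetric] algebra_simps)
    moreover have "x + exp (ln x + s) = x * (1 + exp s)"
      using assms by (simp add: exp_add algebra_simps)
    ultimately show ?thesis
      using assms by simp
  qed
  have "has_bochner_integral lborel (\<lambda>s. exp (t * s) / (1 + exp s)) ?C"
    using integrable_exp_div_one_plus_exp[OF assms(1,2)] by (rule has_bochner_integral_integrable)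
  then have "has_bochner_integral lborel (\<lambda>s. x powr t * (exp (t * s) / (1 + exp s))) (x powr t * ?C)"
    by (rule has_bochner_integral_mult_right)
  then have "has_bochner_integral lborel
      (\<lambda>s. exp (t * (ln x + 1 * s)) * x / (x + exp (ln x + 1 * s))) (x powr t * ?C)"
    by (simp only: mult_1 shift)
  then show ?thesis
    using lborel_has_bochner_integral_real_affine_iff[of 1 "\<lambda>s. exp (t * s) * x / (x + exp s)" "x powr t * ?C" "ln x"]
    by simp
qed

text \<open>
  For \<open>x \<noteq> y\<close> this is the difference of two instances of \<open>powr_integral_representation\<close>, divided
  by \<open>x - y\<close>. On the diagonal the integral is squeezed: it decreases in \<open>y\<close>, so its value at \<open>y = x\<close>
  lies between the values for \<open>y\<close> on either side of \<open>x\<close>, which are difference quotients up to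
  the factor \<open>C\<close> and tend to \<open>C\<close> times the derivative.
\<close>

lemma divdiff_powr_integral:
  fixes t :: real
  assumes "0 < t" "t < 1"
  obtains C where "0 < C"
    and "\<And>x y. 0 < x \<Longrightarrow> 0 < y \<Longrightarrow>
      has_bochner_integral lborel (powr_density t x y) (C * divdiff_powr t x y)"
proof -
  define C where "C = (\<integral>s. exp (t * s) / (1 + exp s) \<partial>lborel)"
  have "C \<noteq> 0"
  proof
    assume "C = 0"
    then have "AE s in lborel. exp (t * s) / (1 + exp s) = 0"
      using integrable_exp_div_one_plus_exp[OF assms] unfolding C_def
      by (subst (asm) integral_nonneg_eq_0_iff_AE) (auto simp: add_pos_pos less_imp_le)
    moreover have "exp (t * s) / (1 + exp s) \<noteq> 0" for s
    proof -
      have "0 < 1 + exp s" using exp_gt_zero[of s] by linarith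
      then show ?thesis by simp
    qed
    ultimately have "AE s in (lborel :: real measure). False"
      by simp
    then show False
      by (simp add: eventually_False ae_filter_eq_bot_iff)
  qed
  moreover have "0 \<le> C"
    unfolding C_def by (intro Bochner_Integration.integral_nonneg) (simp add: add_nonneg_nonneg)
  ultimately have C_pos: "0 < C" by simp
  have off_diag: "has_bochner_integral lborel (powr_density t x y)
      (C * ((x powr t - y powr t) / (x - y)))" if "0 < x" "0 < y" "x \<noteq> y" for x y
  proof -
    have "has_bochner_integral lborel
        (\<lambda>s. (exp (t * s) * x / (x + exp s) - exp (t * s) * y / (y + exp s)) / (x - y))
        ((x powr t * C - y powr t * C) / (x - y))"
      unfolding C_def using that
      by (intro has_bochner_integral_divide has_bochner_integral_diff
          powr_integral_representation[OF assms]) auto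
    moreover have "(exp (t * s) * x / (x + exp s) - exp (t * s) * y / (y + exp s)) / (x - y)
        = powr_density t x y s" for s
    proof -
      have "x + exp s \<noteq> 0" "y + exp s \<noteq> 0" "x - y \<noteq> 0"
        using that add_pos_pos[OF _ exp_gt_zero[of s]] by force+
      then have "(exp (t * s) * x / (x + exp s) - exp (t * s) * y / (y + exp s)) / (x - y)
          = exp (t * s) * exp s / ((x + exp s) * (y + exp s))"
        by (simp add: divide_simps) (simp add: algebra_simps)
      then show ?thesis
        by (simp add: powr_density_def exp_add[symmetric] algebra_simps)
    qed
    ultimately show ?thesis
      by (simp add: algebra_simps)
  qed
  have diag: "has_bochner_integral lborel (powr_density t x x) (C * (t * x powr (t - 1)))"
    if x: "0 < x" for x
  proof -
    have mono: "powr_density t x z s \<le> powr_density t x y s" if "0 < y" "y \<le> z" for y z s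
      unfolding powr_density_def using that x
      by (intro divide_left_mono mult_left_mono mult_pos_pos add_pos_pos) auto
    have nonneg: "0 \<le> powr_density t x y s" if "0 < y" for y s
      unfolding powr_density_def using that x by simp
    \<comment> \<open>The point \<open>x / 2\<close> only serves as an off-diagonal dominating function for integrability.\<close>
    have half: "0 < x / 2" "x / 2 \<noteq> x" using x by auto
    have int: "integrable lborel (powr_density t x x)"
    proof (rule Bochner_Integration.integrable_bound)
      show "integrable lborel (powr_density t x (x / 2))"
        using off_diag[OF x half(1)] x by (auto simp: has_bochner_integral_iff)
      show "powr_density t x x \<in> borel_measurable lborel"
        unfolding powr_density_def by measurable
      show "AE s in lborel. norm (powr_density t x x s) \<le> norm (powr_density t x (x / 2) s)"
        using mono[of "x / 2" x] nonneg[of x] nonneg[of "x / 2"] x by simp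
    qed
    define I where "I = (\<integral>s. powr_density t x x s \<partial>lborel)"
    have I: "has_bochner_integral lborel (powr_density t x x) I"
      unfolding I_def using int by (rule has_bochner_integral_integrable)
    have "((\<lambda>y. y powr t) has_real_derivative t * x powr (t - 1)) (at x)"
      using x by (auto intro!: derivative_eq_intros)
    then have "((\<lambda>y. (y powr t - x powr t) / (y - x)) \<longlongrightarrow> t * x powr (t - 1)) (at x)"
      by (simp add: has_field_derivative_iff)
    then have lim: "((\<lambda>y. C * ((y powr t - x powr t) / (y - x))) \<longlongrightarrow> C * (t * x powr (t - 1))) (at x)"
      by (intro tendsto_intros)
    have flip: "C * ((x powr t - y powr t) / (x - y)) = C * ((y powr t - x powr t) / (y - x))" for y
      by (metis minus_diff_eq minus_divide_divide)
    have below: "C * ((y powr t - x powr t) / (y - x)) \<le> I" if "x < y" for y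
      using has_bochner_integral_mono[OF off_diag[of x y] I] x that mono[of x y]
      unfolding flip by auto
    have above: "I \<le> C * ((y powr t - x powr t) / (y - x))" if "0 < y" "y < x" for y
      using has_bochner_integral_mono[OF I off_diag[of x y]] x that mono[of y x]
      unfolding flip by auto
    have "C * (t * x powr (t - 1)) \<le> I"
    proof (rule tendsto_upperbound)
      show "((\<lambda>y. C * ((y powr t - x powr t) / (y - x))) \<longlongrightarrow> C * (t * x powr (t - 1))) (at_right x)"
        using lim by (rule filterlim_mono) (auto simp: at_le)
      show "eventually (\<lambda>y. C * ((y powr t - x powr t) / (y - x)) \<le> I) (at_right x)"
        using below by (auto simp: eventually_at_filter)
    qed simp
    moreover have "I \<le> C * (t * x powr (t - 1))"
    proof (rule tendsto_lowerbound)
      show "((\<lambda>y. C * ((y powr t - x powr t) / (y - x))) \<longlongrightarrow> C * (t * x powr (t - 1))) (at_left x)"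
        using lim by (rule filterlim_mono) (auto simp: at_le)
      show "eventually (\<lambda>y. I \<le> C * ((y powr t - x powr t) / (y - x))) (at_left x)"
        using x above by (intro eventually_at_leftI[of 0]) auto
    qed simp
    ultimately have "I = C * (t * x powr (t - 1))" by simp
    with I show ?thesis by simp
  qed
  show thesis
    using that[OF C_pos] off_diag diag by (simp add: divdiff_powr_def)
qed

text \<open>
  The reciprocal of the symbol \<open>f_t t (x / y) * y\<close> is, up to the constant \<open>t * (1 - t)\<close>, a product of
  two divided differences of powers with exponents in the unit interval.
\<close>

lemma f_t_reciprocal:
  assumes t: "0 < t" "t < 1" and "0 < x" "0 < y"
  shows "f_t t (x / y) * y * (divdiff_powr t x y * divdiff_powr (1 - t) x y) = t * (1 - t)"
proof (cases "x = y")
  case True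
  then show ?thesis using assms
    by (simp add: f_t_def divdiff_powr_def powr_diff powr_minus divide_simps)
next
  case False
  have pw: "(x / y) powr a = x powr a / y powr a" for a
    using assms by (simp add: powr_divide)
  have ne: "x powr a \<noteq> y powr a" if "0 < a" for a
    using powr_inj[of x y] powr_less_mono2[of a x y] powr_less_mono2[of a y x] False assms that by linarith
  have prod: "y powr t * y powr (1 - t) = y"
    using assms by (simp add: powr_add[symmetric])
  have "((x / y) powr t - 1) * ((x / y) powr (1 - t) - 1)
      = (x powr t - y powr t) * (x powr (1 - t) - y powr (1 - t)) / (y powr t * y powr (1 - t))"
    using assms by (simp add: pw field_simps)
  also have "\<dots> = (x powr t - y powr t) * (x powr (1 - t) - y powr (1 - t)) / y"
    by (simp only: prod)
  finally have den: "((x / y) powr t - 1) * ((x / y) powr (1 - t) - 1)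
      = (x powr t - y powr t) * (x powr (1 - t) - y powr (1 - t)) / y" .
  have "x / y \<noteq> 1" using False assms by simp
  moreover have "x / y - 1 = (x - y) / y" using assms by (simp add: field_simps)
  moreover have "x powr t - y powr t \<noteq> 0" "x powr (1 - t) - y powr (1 - t) \<noteq> 0"
    using ne t by auto
  ultimately show ?thesis
    using False assms
    by (simp add: f_t_def divdiff_powr_def den power2_eq_square)
qed

section \<open>Positive semidefinite kernels\<close>

text \<open>
  The order on \<^typ>\<open>complex\<close> makes this the condition that all values of the quadratic form are real
  and nonnegative. Working with functions instead of matrices spares dimension conditions.
\<close>

definition psd_kernel :: "'a set \<Rightarrow> ('a \<Rightarrow> 'a \<Rightarrow> complex) \<Rightarrow> bool" where
  "psd_kernel I N \<longleftrightarrow> (\<forall>c. 0 \<le> (\<Sum>i\<in>I. \<Sum>j\<in>I. cnj (c i) * N i j * c j))"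

lemma psd_kernel_cong:
  assumes "psd_kernel I N" "\<And>i j. i \<in> I \<Longrightarrow> j \<in> I \<Longrightarrow> N i j = N' i j"
  shows "psd_kernel I N'"
  using assms by (simp add: psd_kernel_def cong: sum.cong)

lemma psd_kernel_scale:
  assumes "psd_kernel I N" "0 \<le> (c :: complex)"
  shows "psd_kernel I (\<lambda>i j. c * N i j)"
  unfolding psd_kernel_def
proof
  fix x
  have "(\<Sum>i\<in>I. \<Sum>j\<in>I. cnj (x i) * (c * N i j) * x j) = c * (\<Sum>i\<in>I. \<Sum>j\<in>I. cnj (x i) * N i j * x j)"
    by (simp add: sum_distrib_left mult_ac)
  then show "0 \<le> (\<Sum>i\<in>I. \<Sum>j\<in>I. cnj (x i) * (c * N i j) * x j)"
    using assms by (simp add: psd_kernel_def)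
qed

text \<open>
  A Schur product with the rank one kernel \<open>g(x\<^sub>i) g(x\<^sub>j)\<close> for real \<open>g\<close> replaces the test vector \<open>c\<^sub>i\<close>
  by \<open>c\<^sub>i g(x\<^sub>i)\<close>, so it preserves positivity. The divided difference is an integral of
  positive multiples of such kernels, with \<open>g(x) = 1 / (x + exp s)\<close>.
\<close>

lemma psd_kernel_schur_divdiff_powr:
  fixes N :: "'a \<Rightarrow> 'a \<Rightarrow> complex"
  assumes t: "0 < t" "t < 1" and x: "\<And>i. i \<in> I \<Longrightarrow> 0 < x i" and N: "psd_kernel I N"
  shows "psd_kernel I (\<lambda>i j. divdiff_powr t (x i) (x j) * N i j)"
  unfolding psd_kernel_def
proof
  fix c :: "'a \<Rightarrow> complex"
  obtain C where C: "0 < C" and int: "\<And>x y. 0 < x \<Longrightarrow> 0 < y \<Longrightarrow>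
      has_bochner_integral lborel (powr_density t x y) (C * divdiff_powr t x y)"
    using divdiff_powr_integral[OF t] by blast
  let ?Q = "\<Sum>i\<in>I. \<Sum>j\<in>I. cnj (c i) * (divdiff_powr t (x i) (x j) * N i j) * c j"
  define F where "F = (\<lambda>s. \<Sum>i\<in>I. \<Sum>j\<in>I. cnj (c i) * N i j * c j * powr_density t (x i) (x j) s)"
  have "has_bochner_integral lborel F
      (\<Sum>i\<in>I. \<Sum>j\<in>I. cnj (c i) * N i j * c j * complex_of_real (C * divdiff_powr t (x i) (x j)))"
    unfolding F_def
    by (intro has_bochner_integral_sum has_bochner_integral_mult_right has_bochner_integral_of_real
        int x)
  also have "(\<Sum>i\<in>I. \<Sum>j\<in>I. cnj (c i) * N i j * c j * complex_of_real (C * divdiff_powr t (x i) (x j)))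
      = C * ?Q"
    by (simp add: sum_distrib_left algebra_simps)
  finally have F_int: "has_bochner_integral lborel F (C * ?Q)" .
  have F_nonneg: "0 \<le> F s" for s
  proof -
    \<comment> \<open>The rescaled test vector that absorbs the rank one factors of the density.\<close>
    define d where "d = (\<lambda>i. c i * (1 / (x i + exp s)))"
    have "F s = exp ((t + 1) * s) * (\<Sum>i\<in>I. \<Sum>j\<in>I. cnj (d i) * N i j * d j)"
      unfolding F_def d_def powr_density_def sum_distrib_left
      by (intro sum.cong refl) (simp add: divide_simps)
    also have "\<dots> \<ge> 0"
      using N unfolding psd_kernel_def
      by (intro mult_nonneg_nonneg) (auto simp: less_eq_complex_def)
    finally show ?thesis .
  qed
  have "0 \<le> Re (C * ?Q)"
    using has_bochner_integral_mono[OF has_bochner_integral_zero has_bochner_integral_Re[OF F_int]]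
      F_nonneg
    by (simp add: less_eq_complex_def)
  moreover have "Im (C * ?Q) = 0"
  proof -
    have "Im (F s) = 0" for s using F_nonneg[of s] by (simp add: less_eq_complex_def)
    then show ?thesis
      using has_bochner_integral_Im[OF F_int] by (auto dest: has_bochner_integral_integral_eq)
  qed
  ultimately show "0 \<le> ?Q"
    using C by (simp add: less_eq_complex_def zero_le_mult_iff)
qed

section \<open>Unitary diagonalization of positive definite matrices\<close>

lemma mat_adjoint_dim [simp]: "dim_row (mat_adjoint A) = dim_col A" "dim_col (mat_adjoint A) = dim_row A"
  by (simp_all add: mat_adjoint_def)

lemma mat_adjoint_carrier [simp]:
  "A \<in> carrier_mat n m \<Longrightarrow> mat_adjoint A \<in> carrier_mat m n"
  by auto

lemma mat_adjoint_index [simp]: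
  fixes A :: "complex mat"
  assumes "i < dim_col A" "j < dim_row A"
  shows "mat_adjoint A $$ (i, j) = cnj (A $$ (j, i))"
  using assms by (simp add: mat_adjoint_def mat_of_rows_def)

lemma mat_adjoint_adjoint [simp]: "mat_adjoint (mat_adjoint A) = (A :: complex mat)"
  by (rule eq_matI) auto

lemma mult_mat_index_sum:
  assumes "A \<in> carrier_mat n m" "B \<in> carrier_mat m k" "i < n" "j < k"
  shows "(A * B) $$ (i, j) = (\<Sum>l<m. A $$ (i, l) * B $$ (l, j))"
  using assms by (auto simp: scalar_prod_def lessThan_atLeast0 intro!: sum.cong)

lemma mat_adjoint_mult:
  fixes A B :: "complex mat"
  assumes "A \<in> carrier_mat n m" "B \<in> carrier_mat m k"
  shows "mat_adjoint (A * B) = mat_adjoint B * mat_adjoint A"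
proof (rule eq_matI)
  fix i j assume "i < dim_row (mat_adjoint B * mat_adjoint A)" "j < dim_col (mat_adjoint B * mat_adjoint A)"
  then have ij: "i < k" "j < n" using assms by auto
  then show "mat_adjoint (A * B) $$ (i, j) = (mat_adjoint B * mat_adjoint A) $$ (i, j)"
    using assms
    by (auto simp: mult_mat_index_sum[of _ n m _ k] mult_mat_index_sum[of _ k m _ n] mult.commute
        simp del: index_mult_mat(1) intro!: sum.cong)
qed (use assms in auto)

lemma quadratic_form_sum:
  fixes A :: "complex mat"
  assumes "A \<in> carrier_mat n n" "v \<in> carrier_vec n"
  shows "(A *\<^sub>v v) \<bullet>c v = (\<Sum>i<n. \<Sum>j<n. cnj (v $ i) * A $$ (i, j) * v $ j)"
  using assms
  by (auto simp: scalar_prod_def lessThan_atLeast0 sum_distrib_right sum_distrib_left algebra_simps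
      intro!: sum.cong)

text \<open>
  Polarization: the quadratic form takes real values on the basis vectors \<open>e\<^sub>i\<close> and on the vectors
  \<open>e\<^sub>i + c e\<^sub>j\<close>, and \<open>c = 1\<close> and \<open>c = \<i>\<close> together determine the entry at \<open>(j, i)\<close> from the one at
  \<open>(i, j)\<close>.
\<close>

lemma pos_def_hermitian:
  assumes "pos_def n A"
  shows "mat_adjoint A = A"
proof (rule eq_matI)
  have cnj_delta: "cnj (if P then x else 0) = (if P then cnj x else 0)" for P x
    by simp
  note delta_simps = mult_delta_left mult_delta_right cnj_delta
  have A: "A \<in> carrier_mat n n" using assms by (simp add: pos_def_def)
  have real: "Im ((A *\<^sub>v v) \<bullet>c v) = 0" if "v \<in> carrier_vec n" for v
  proof (cases "v = 0\<^sub>v n")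
    case True
    then show ?thesis using A by (simp add: quadratic_form_sum)
  next
    case False
    then have "0 < (A *\<^sub>v v) \<bullet>c v" using assms that by (simp add: pos_def_def)
    then show ?thesis by (simp add: less_complex_def)
  qed
  have diag: "Im (A $$ (i, i)) = 0" if "i < n" for i
  proof -
    have "(A *\<^sub>v unit_vec n i) \<bullet>c unit_vec n i = A $$ (i, i)"
      using A that by (simp add: quadratic_form_sum delta_simps)
    then show ?thesis using real[of "unit_vec n i"] by simp
  qed
  have pair: "Im (c * A $$ (i, j) + cnj c * A $$ (j, i)) = 0" if ij: "i < n" "j < n" "i \<noteq> j" for i j c
  proof -
    define v where "v = vec n (\<lambda>k. (if k = i then 1 else 0) + (if k = j then c else 0))"
    have expand: "(A *\<^sub>v v) \<bullet>c v =
        A $$ (i, i) + c * A $$ (i, j) + (cnj c * A $$ (j, i) + (cnj c * c) * A $$ (j, j))"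
      using A ij
      by (simp add: v_def quadratic_form_sum delta_simps distrib_left distrib_right sum.distrib)
    have "Im ((cnj c * c) * A $$ (j, j)) = 0"
      using diag[OF ij(2)] by simp
    moreover have "Im ((A *\<^sub>v v) \<bullet>c v) = 0"
      by (rule real) (simp add: v_def)
    ultimately show ?thesis
      using diag[OF ij(1)] unfolding expand by (simp only: plus_complex.sel)
  qed
  fix i j assume "i < dim_row A" "j < dim_col A"
  then have ij: "i < n" "j < n" using A by auto
  show "mat_adjoint A $$ (i, j) = A $$ (i, j)"
  proof (cases "i = j")
    case True
    then show ?thesis using diag ij A by (simp add: complex_eq_iff)
  next
    case False
    then show ?thesis
      using pair[of i j 1] pair[of i j \<i>] ij A by (auto simp: complex_eq_iff)
  qed
qed (use assms in \<open>auto simp: pos_def_def\<close>)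

abbreviation diagonal :: "nat \<Rightarrow> (nat \<Rightarrow> complex) \<Rightarrow> complex mat" where
  "diagonal n d \<equiv> mat n n (\<lambda>(i, j). if i = j then d i else 0)"

text \<open>
  Gram--Schmidt orthogonalization as provided by \<open>gram_schmidt\<close> does not normalize, so the columns
  are divided by their norms here.
\<close>

lemma corthogonal_normalize:
  fixes ws :: "complex vec list"
  assumes ws: "set ws \<subseteq> carrier_vec n" "corthogonal ws" "length ws = n"
  defines "W \<equiv> mat n n (\<lambda>(i, j). ws ! j $ i / sqrt (Re (ws ! j \<bullet>c ws ! j)))"
  shows "mat_adjoint W * W = 1\<^sub>m n"
proof (rule eq_matI)
  have W: "W \<in> carrier_mat n n" by (simp add: W_def)
  fix i j assume "i < dim_row (1\<^sub>m n :: complex mat)" "j < dim_col (1\<^sub>m n :: complex mat)"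
  then have ij: "i < n" "j < n" by auto
  have dims: "dim_vec (ws ! k) = n" if "k < n" for k
    using that ws by (metis carrier_vecD nth_mem subsetD)
  let ?N = "\<lambda>k. complex_of_real (sqrt (Re (ws ! k \<bullet>c ws ! k)))"
  have "(mat_adjoint W * W) $$ (i, j) =
      (\<Sum>k<n. cnj (ws ! i $ k) * (ws ! j $ k)) / (?N i * ?N j)"
    using ij W
    by (subst mult_mat_index_sum[of _ n n _ n])
      (auto simp: W_def sum_divide_distrib intro!: sum.cong)
  also have "(\<Sum>k<n. cnj (ws ! i $ k) * (ws ! j $ k)) = ws ! j \<bullet>c ws ! i"
    using dims ij by (auto simp: scalar_prod_def lessThan_atLeast0 intro!: sum.cong)
  also have "(ws ! j \<bullet>c ws ! i) / (?N i * ?N j) = (if i = j then 1 else 0)"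
  proof (cases "i = j")
    case False
    then have "ws ! j \<bullet>c ws ! i = 0"
      using corthogonalD[OF ws(2)] ij ws(3) by auto
    then show ?thesis using False by simp
  next
    case True
    let ?s = "ws ! i \<bullet>c ws ! i"
    have "?s \<noteq> 0" using corthogonalD[OF ws(2), of i i] ij ws(3) by auto
    moreover have "0 \<le> ?s" by (rule conjugate_square_ge_0_vec)
    ultimately have s: "?s = of_real (Re ?s)" "0 < Re ?s"
      by (auto simp: less_eq_complex_def complex_eq_iff)
    then have "?N i * ?N i = ?s"
      by (metis less_imp_le of_real_mult real_sqrt_mult_self abs_of_nonneg)
    then show ?thesis using True \<open>?s \<noteq> 0\<close> by simp
  qed
  finally show "(mat_adjoint W * W) $$ (i, j) = 1\<^sub>m n $$ (i, j)"
    using ij by simp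
qed (auto simp: W_def)

lemma exists_eigenvalue:
  fixes A :: "complex mat"
  assumes A: "A \<in> carrier_mat n n" and "n \<noteq> 0"
  obtains e where "eigenvalue A e"
proof -
  obtain as where as: "char_poly A = (\<Prod>a\<leftarrow>as. [:- a, 1:])" "length as = n"
    using char_poly_factorized[OF A] by blast
  then obtain a bs where "as = a # bs" using \<open>n \<noteq> 0\<close> by (cases as) auto
  with as have "poly (char_poly A) a = 0" by simp
  then show thesis using that eigenvalue_root_char_poly[OF A] by blast
qed

text \<open>
  An eigenvector, extended to a basis and orthonormalized, survives as the first column up to
  a scalar. This is the deflation step of \<open>hermitian_diagonalization\<close>.
\<close>

lemma unitary_with_first_eigenvector:
  fixes A :: "complex mat"
  assumes A: "A \<in> carrier_mat (Suc n) (Suc n)"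
  obtains W e where "W \<in> carrier_mat (Suc n) (Suc n)" "mat_adjoint W * W = 1\<^sub>m (Suc n)"
    "\<And>i. i < Suc n \<Longrightarrow> (A * W) $$ (i, 0) = e * W $$ (i, 0)"
proof -
  interpret cof_vec_space "Suc n" "TYPE(complex)" .
  obtain e where "eigenvalue A e" using exists_eigenvalue[OF A] by blast
  then obtain v where v: "v \<in> carrier_vec (Suc n)" "v \<noteq> 0\<^sub>v (Suc n)" "A *\<^sub>v v = e \<cdot>\<^sub>v v"
    using A unfolding eigenvalue_def eigenvector_def by auto
  note b = basis_completion[OF v(1,2)]
  define ws where "ws = gram_schmidt (Suc n) (basis_completion v)"
  have ws: "set ws \<subseteq> carrier_vec (Suc n)" "corthogonal ws" "length ws = Suc n"
    using gram_schmidt_result[OF b(2,4,5) ws_def] b(6) by auto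
  obtain vs where vs: "basis_completion v = v # vs"
    using b(6,7) by (cases "basis_completion v") auto
  then have "hd ws = v" using gram_schmidt_hd[OF v(1)] by (simp add: ws_def)
  then have ws0: "ws ! 0 = v" using ws(3) by (metis hd_conv_nth list.size(3) nat.distinct(1))
  define W where "W = mat (Suc n) (Suc n) (\<lambda>(i, j). ws ! j $ i / sqrt (Re (ws ! j \<bullet>c ws ! j)))"
  have W: "W \<in> carrier_mat (Suc n) (Suc n)" by (simp add: W_def)
  have "(A * W) $$ (i, 0) = e * W $$ (i, 0)" if i: "i < Suc n" for i
  proof -
    have "(A * W) $$ (i, 0) = (\<Sum>k<Suc n. A $$ (i, k) * v $ k) / sqrt (Re (v \<bullet>c v))"
      using i by (subst mult_mat_index_sum[OF A W])
        (auto simp: W_def ws0 sum_divide_distrib simp del: sum.lessThan_Suc intro!: sum.cong)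
    also have "(\<Sum>k<Suc n. A $$ (i, k) * v $ k) = (A *\<^sub>v v) $ i"
      using i A v(1) by (auto simp: scalar_prod_def lessThan_atLeast0
          simp del: sum.lessThan_Suc sum.op_ivl_Suc intro!: sum.cong)
    also have "\<dots> = e * v $ i" using v i by simp
    finally show ?thesis using i by (simp add: W_def ws0)
  qed
  with that W show thesis
    using corthogonal_normalize[OF ws] by (metis W_def)
qed

text \<open>
  Induction on the dimension. Conjugation by the unitary matrix of \<open>unitary_with_first_eigenvector\<close>
  clears the first column below the diagonal, and hermiticity then clears the first row, which leaves
  a hermitian block of smaller size.
\<close>

lemma hermitian_diagonalization:
  fixes A :: "complex mat"
  assumes "A \<in> carrier_mat n n" "mat_adjoint A = A"
  obtains U d where "U \<in> carrier_mat n n" "mat_adjoint U * U = 1\<^sub>m n"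
    "mat_adjoint U * A * U = diagonal n d"
proof -
  have "\<exists>U d. U \<in> carrier_mat n n \<and> mat_adjoint U * U = 1\<^sub>m n \<and> mat_adjoint U * A * U = diagonal n d"
    using assms
  proof (induction n arbitrary: A)
    case 0
    then show ?case by (intro exI[of _ "1\<^sub>m 0"] exI[of _ "\<lambda>_. 0"] conjI eq_matI) auto
  next
    case (Suc n)
    let ?N = "Suc n"
    note A = Suc.prems(1)
    obtain W e where W: "W \<in> carrier_mat ?N ?N" and WW: "mat_adjoint W * W = 1\<^sub>m ?N"
      and AW: "\<And>i. i < ?N \<Longrightarrow> (A * W) $$ (i, 0) = e * W $$ (i, 0)"
      using unitary_with_first_eigenvector[OF A] by blast
    define A' where "A' = mat_adjoint W * A * W"
    have A': "A' \<in> carrier_mat ?N ?N" using A W by (simp add: A'_def mult_carrier_mat[of _ ?N ?N _ ?N])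
    have herm: "mat_adjoint A' = A'"
      using A W Suc.prems(2) unfolding A'_def
      by (simp add: mat_adjoint_mult[of _ ?N ?N _ ?N] assoc_mult_mat[of _ ?N ?N _ ?N _ ?N]
        mult_carrier_mat[of _ ?N ?N _ ?N])
    have A'_sym: "A' $$ (i, j) = cnj (A' $$ (j, i))" if "i < ?N" "j < ?N" for i j
      using mat_adjoint_index[of i A' j] herm A' that by auto
    have col0: "A' $$ (i, 0) = (if i = 0 then e else 0)" if i: "i < ?N" for i
    proof -
      have "A' $$ (i, 0) = (mat_adjoint W * (A * W)) $$ (i, 0)"
        using A W by (simp add: A'_def assoc_mult_mat[of _ ?N ?N _ ?N _ ?N]
        mult_carrier_mat[of _ ?N ?N _ ?N])
      also have "\<dots> = (\<Sum>k<?N. mat_adjoint W $$ (i, k) * (A * W) $$ (k, 0))"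
        using A W i by (intro mult_mat_index_sum) auto
      also have "\<dots> = (\<Sum>k<?N. e * (mat_adjoint W $$ (i, k) * W $$ (k, 0)))"
        using AW by (intro sum.cong) auto
      also have "\<dots> = e * (mat_adjoint W * W) $$ (i, 0)"
        using W i by (subst mult_mat_index_sum[of _ ?N ?N _ ?N]) (auto simp: sum_distrib_left
            simp del: sum.lessThan_Suc)
      finally show ?thesis using i by (simp add: WW)
    qed
    define B where "B = mat n n (\<lambda>(i, j). A' $$ (Suc i, Suc j))"
    have B: "B \<in> carrier_mat n n" by (simp add: B_def)
    have A'_block: "A' = four_block_mat (diagonal 1 (\<lambda>_. e)) (0\<^sub>m 1 n) (0\<^sub>m n 1) B"
    proof (rule eq_matI)
      fix i j
      assume "i < dim_row (four_block_mat (diagonal 1 (\<lambda>_. e)) (0\<^sub>m 1 n) (0\<^sub>m n 1) B)"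
        "j < dim_col (four_block_mat (diagonal 1 (\<lambda>_. e)) (0\<^sub>m 1 n) (0\<^sub>m n 1) B)"
      then have "i < ?N" "j < ?N" by (auto simp: B_def)
      then show "A' $$ (i, j) = four_block_mat (diagonal 1 (\<lambda>_. e)) (0\<^sub>m 1 n) (0\<^sub>m n 1) B $$ (i, j)"
        using col0 A'_sym[of 0 j] by (cases i; cases j) (auto simp: B_def)
    qed (use A' in \<open>auto simp: B_def\<close>)
    have "cnj (B $$ (j, i)) = B $$ (i, j)" if "i < n" "j < n" for i j
      using A'_sym[of "Suc i" "Suc j"] that by (simp add: B_def)
    then have "mat_adjoint B = B"
      using B by (intro eq_matI) auto
    then obtain V d where V: "V \<in> carrier_mat n n" and VV: "mat_adjoint V * V = 1\<^sub>m n"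
      and VBV: "mat_adjoint V * B * V = diagonal n d"
      using Suc.IH[OF B] by blast
    define V' where "V' = four_block_mat (1\<^sub>m 1) (0\<^sub>m 1 n) (0\<^sub>m n 1) V"
    have V': "V' \<in> carrier_mat ?N ?N"
      unfolding V'_def using four_block_carrier_mat[of "1\<^sub>m 1" 1 1 V n n] V by simp
    have V'_adj: "mat_adjoint V' = four_block_mat (1\<^sub>m 1) (0\<^sub>m 1 n) (0\<^sub>m n 1) (mat_adjoint V)"
      using V by (intro eq_matI) (auto simp: V'_def)
    have V'V': "mat_adjoint V' * V' = 1\<^sub>m ?N"
    proof -
      have "mat_adjoint V' * V' = four_block_mat (1\<^sub>m 1) (0\<^sub>m 1 n) (0\<^sub>m n 1) (1\<^sub>m n)"
        unfolding V'_adj unfolding V'_def using V VV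
        by (subst mult_four_block_mat[of _ 1 1 _ n _ n _ _ 1 _ n]) auto
      then show ?thesis by simp
    qed
    have VB: "mat_adjoint V * B \<in> carrier_mat n n" using V B by (simp add: mult_carrier_mat[of _ n n])
    have "mat_adjoint V' * A' = four_block_mat (diagonal 1 (\<lambda>_. e)) (0\<^sub>m 1 n) (0\<^sub>m n 1) (mat_adjoint V * B)"
      unfolding V'_adj A'_block using V B VB
      by (subst mult_four_block_mat[of _ 1 1 _ n _ n _ _ 1 _ n]) simp_all
    moreover have "four_block_mat (diagonal 1 (\<lambda>_. e)) (0\<^sub>m 1 n) (0\<^sub>m n 1) (mat_adjoint V * B) * V' =
        four_block_mat (diagonal 1 (\<lambda>_. e)) (0\<^sub>m 1 n) (0\<^sub>m n 1) (mat_adjoint V * B * V)"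
      unfolding V'_def using V VB
      by (subst mult_four_block_mat[of _ 1 1 _ n _ n _ _ 1 _ n]) (simp_all add: right_mult_zero_mat[OF VB])
    ultimately have conj: "mat_adjoint V' * A' * V' =
        four_block_mat (diagonal 1 (\<lambda>_. e)) (0\<^sub>m 1 n) (0\<^sub>m n 1) (diagonal n d)"
      by (simp only: VBV)
    define U where "U = W * V'"
    have U: "U \<in> carrier_mat ?N ?N" using W V' by (simp add: U_def)
    have "mat_adjoint U * U = mat_adjoint V' * (mat_adjoint W * W) * V'"
      unfolding U_def using W V'
      by (simp add: mat_adjoint_mult[of _ ?N ?N _ ?N] assoc_mult_mat[of _ ?N ?N _ ?N _ ?N]
        mult_carrier_mat[of _ ?N ?N _ ?N])
    then have UU: "mat_adjoint U * U = 1\<^sub>m ?N"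
      using V' V'V' by (simp add: WW)
    have "mat_adjoint U * A * U = mat_adjoint V' * A' * V'"
      unfolding U_def A'_def using A W V'
      by (simp add: mat_adjoint_mult[of _ ?N ?N _ ?N] assoc_mult_mat[of _ ?N ?N _ ?N _ ?N]
        mult_carrier_mat[of _ ?N ?N _ ?N])
    also have "\<dots> = diagonal ?N (case_nat e d)"
      unfolding conj
    proof (rule eq_matI)
      fix i j assume "i < dim_row (diagonal ?N (case_nat e d))" "j < dim_col (diagonal ?N (case_nat e d))"
      then show "four_block_mat (diagonal 1 (\<lambda>_. e)) (0\<^sub>m 1 n) (0\<^sub>m n 1) (diagonal n d) $$ (i, j) =
          diagonal ?N (case_nat e d) $$ (i, j)"
        by (cases i; cases j) simp_all
    qed simp_all
    finally show ?case using U UU by blast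
  qed
  then show thesis using that by blast
qed

text \<open>
  Each diagonal entry is the quadratic form of \<open>D\<close> at a column of \<open>U\<close>, hence positive.
\<close>

lemma pos_def_diagonalization:
  assumes "pos_def n D"
  obtains U and d :: "nat \<Rightarrow> real" where "U \<in> carrier_mat n n" "mat_adjoint U * U = 1\<^sub>m n"
    "mat_adjoint U * D * U = diagonal n (\<lambda>i. of_real (d i))" "\<And>i. i < n \<Longrightarrow> 0 < d i"
proof -
  have D: "D \<in> carrier_mat n n" using assms by (simp add: pos_def_def)
  obtain U d where U: "U \<in> carrier_mat n n" "mat_adjoint U * U = 1\<^sub>m n"
    and diag: "mat_adjoint U * D * U = diagonal n d"
    using hermitian_diagonalization[OF D pos_def_hermitian[OF assms]] by blast
  have pos: "0 < d i" if i: "i < n" for i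
  proof -
    have "col U i \<noteq> 0\<^sub>v n"
    proof
      assume "col U i = 0\<^sub>v n"
      then have "(mat_adjoint U * U) $$ (i, i) = 0"
        using U(1) i by simp
      then have "1\<^sub>m n $$ (i, i) = (0 :: complex)" by (simp only: U(2))
      then show False using i by simp
    qed
    then have "0 < (D *\<^sub>v col U i) \<bullet>c col U i"
      using assms U(1) i by (simp add: pos_def_def)
    also have "(D *\<^sub>v col U i) \<bullet>c col U i = (mat_adjoint U * (D * U)) $$ (i, i)"
    proof -
      have "(mat_adjoint U * (D * U)) $$ (i, i) = (\<Sum>k<n. mat_adjoint U $$ (i, k) * (D * U) $$ (k, i))"
        using U D i by (intro mult_mat_index_sum) auto
      also have "\<dots> = (\<Sum>k<n. \<Sum>l<n. cnj (U $$ (k, i)) * (D $$ (k, l) * U $$ (l, i)))"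
        using U D i by (intro sum.cong) (auto simp: mult_mat_index_sum[OF D U(1)] sum_distrib_left
            simp del: index_mult_mat(1))
      finally show ?thesis
        using U D i by (subst quadratic_form_sum[of _ n]) (auto simp: algebra_simps intro!: sum.cong)
    qed
    also have "\<dots> = d i"
      using diag U D i by (simp flip: assoc_mult_mat[of _ n n _ n _ n])
    finally show ?thesis .
  qed
  show thesis
  proof (rule that[OF U])
    show "mat_adjoint U * D * U = diagonal n (\<lambda>i. of_real (Re (d i)))"
      unfolding diag using pos by (intro eq_matI) (auto simp: less_complex_def complex_eq_iff)
    show "0 < Re (d i)" if "i < n" for i using pos[OF that] by (simp add: less_complex_def)
  qed
qed

section \<open>Schur multipliers in an orthonormal basis\<close>

lemma mat_trace_comm:
  fixes A B :: "complex mat"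
  assumes "A \<in> carrier_mat n m" "B \<in> carrier_mat m n"
  shows "sum_list (diag_mat (A * B)) = sum_list (diag_mat (B * A))"
proof -
  have "sum_list (diag_mat (A * B)) = (\<Sum>i<n. \<Sum>k<m. A $$ (i, k) * B $$ (k, i))"
    using assms by (auto simp: diag_mat_def interv_sum_list_conv_sum_set_nat lessThan_atLeast0
        mult_mat_index_sum[OF assms] simp del: index_mult_mat(1) intro!: sum.cong)
  also have "\<dots> = (\<Sum>k<m. \<Sum>i<n. B $$ (k, i) * A $$ (i, k))"
    by (subst sum.swap) (simp add: mult.commute)
  also have "\<dots> = sum_list (diag_mat (B * A))"
    using assms by (auto simp: diag_mat_def interv_sum_list_conv_sum_set_nat lessThan_atLeast0
        mult_mat_index_sum[OF assms(2,1)] simp del: index_mult_mat(1) intro!: sum.cong)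
  finally show ?thesis .
qed

lemma hs_inner_sum:
  assumes "A \<in> carrier_mat n m" "B \<in> carrier_mat n m"
  shows "hs_inner A B = (\<Sum>i<n. \<Sum>j<m. cnj (A $$ (i, j)) * B $$ (i, j))"
proof -
  have "hs_inner A B = (\<Sum>j<m. \<Sum>i<n. cnj (A $$ (i, j)) * B $$ (i, j))"
    unfolding hs_inner_def using assms
    by (auto simp: diag_mat_def interv_sum_list_conv_sum_set_nat lessThan_atLeast0
        mult_mat_index_sum[of _ m n _ m] simp del: index_mult_mat(1) intro!: sum.cong)
  then show ?thesis by (subst sum.swap)
qed

text \<open>
  The three facts below reindex and rearrange the quadratic form of an \<open>m * n\<close> dimensional block matrix, whose
  index \<open>k * n + a\<close> means position \<open>a\<close> in block \<open>k\<close>.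
\<close>

lemma sum_nat_blocks:
  fixes g :: "nat \<Rightarrow> 'a :: comm_monoid_add"
  shows "(\<Sum>p<m * n. g p) = (\<Sum>k<m. \<Sum>a<n. g (k * n + a))"
proof -
  have "(\<Sum>p<m * n. g p) = (\<Sum>k<m. sum g {k * n..<k * n + n})"
    by (simp add: sum.nat_group)
  also have "\<dots> = (\<Sum>k<m. \<Sum>a<n. g (k * n + a))"
    by (rule sum.cong[OF refl], subst sum.atLeastLessThan_shift_0) (simp add: lessThan_atLeast0)
  finally show ?thesis .
qed

lemma block_index_less:
  fixes k m a n :: nat
  assumes "k < m" "a < n"
  shows "k * n + a < m * n"
proof -
  have "k * n + a < Suc k * n" using assms by simp
  also have "\<dots> \<le> m * n" using assms by (intro mult_le_mono1) simp
  finally show ?thesis .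
qed

lemma sum_swap_pairs:
  "(\<Sum>a\<in>A. \<Sum>b\<in>B. \<Sum>i\<in>I. \<Sum>j\<in>J. f a b i j) = (\<Sum>i\<in>I. \<Sum>j\<in>J. \<Sum>a\<in>A. \<Sum>b\<in>B. f a b i j)"
proof -
  have "(\<Sum>a\<in>A. \<Sum>b\<in>B. \<Sum>i\<in>I. \<Sum>j\<in>J. f a b i j) = (\<Sum>a\<in>A. \<Sum>i\<in>I. \<Sum>j\<in>J. \<Sum>b\<in>B. f a b i j)"
    by (subst (2) sum.swap, subst (3) sum.swap) (rule refl)
  also have "\<dots> = (\<Sum>i\<in>I. \<Sum>a\<in>A. \<Sum>j\<in>J. \<Sum>b\<in>B. f a b i j)"
    by (rule sum.swap)
  also have "\<dots> = (\<Sum>i\<in>I. \<Sum>j\<in>J. \<Sum>a\<in>A. \<Sum>b\<in>B. f a b i j)"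
    by (rule sum.cong[OF refl], rule sum.swap)
  finally show ?thesis .
qed

text \<open>
  The columns of \<open>U\<close> are an orthonormal basis of complex \<open>n\<close>-space; \<open>coords X\<close> below is the matrix of
  \<open>X\<close> with respect to it. Conjugation by \<open>U\<close> is an algebra automorphism and an isometry for the
  Hilbert--Schmidt inner product, so identities of matrices are checked on coordinates.
\<close>

locale orthonormal_basis =
  fixes n :: nat and U :: "complex mat"
  assumes U: "U \<in> carrier_mat n n" and UU: "mat_adjoint U * U = 1\<^sub>m n"
begin

lemma U_adj [simp]: "mat_adjoint U \<in> carrier_mat n n"
  using U by simp

lemma UU': "U * mat_adjoint U = 1\<^sub>m n"
  using mat_mult_left_right_inverse[OF U_adj U UU] .

lemmas square_simps = mult_carrier_mat[of _ n n _ n] assoc_mult_mat[of _ n n _ n _ n]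

definition coords :: "complex mat \<Rightarrow> complex mat" where
  "coords X = mat_adjoint U * X * U"

definition of_coords :: "complex mat \<Rightarrow> complex mat" where
  "of_coords Y = U * Y * mat_adjoint U"

lemma coords_carrier [simp]: "X \<in> carrier_mat n n \<Longrightarrow> coords X \<in> carrier_mat n n"
  using U by (simp add: coords_def square_simps)

lemma of_coords_carrier [simp]: "Y \<in> carrier_mat n n \<Longrightarrow> of_coords Y \<in> carrier_mat n n"
  using U by (simp add: of_coords_def square_simps)

lemma coords_of_coords [simp]:
  assumes "Y \<in> carrier_mat n n"
  shows "coords (of_coords Y) = Y"
proof -
  have "coords (of_coords Y) = (mat_adjoint U * U) * Y * (mat_adjoint U * U)"
    using U assms by (simp add: coords_def of_coords_def square_simps)
  then show ?thesis using assms by (simp add: UU)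
qed

lemma of_coords_coords [simp]:
  assumes "X \<in> carrier_mat n n"
  shows "of_coords (coords X) = X"
proof -
  have "of_coords (coords X) = (U * mat_adjoint U) * X * (U * mat_adjoint U)"
    using U assms by (simp add: coords_def of_coords_def square_simps)
  then show ?thesis using assms by (simp add: UU')
qed

lemma eq_if_coords_eq:
  assumes "X \<in> carrier_mat n n" "Y \<in> carrier_mat n n"
    and "\<And>i j. i < n \<Longrightarrow> j < n \<Longrightarrow> coords X $$ (i, j) = coords Y $$ (i, j)"
  shows "X = Y"
proof -
  have "coords X = coords Y"
    using assms coords_carrier[OF assms(1)] coords_carrier[OF assms(2)]
    by (intro eq_matI) (metis carrier_matD)+
  then show ?thesis using assms by (metis of_coords_coords)
qed

lemma coords_index:
  assumes "X \<in> carrier_mat n n" "i < n" "j < n"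
  shows "coords X $$ (i, j) = (\<Sum>a<n. \<Sum>b<n. cnj (U $$ (a, i)) * X $$ (a, b) * U $$ (b, j))"
proof -
  have "coords X $$ (i, j) = (\<Sum>b<n. (mat_adjoint U * X) $$ (i, b) * U $$ (b, j))"
    unfolding coords_def using U assms by (intro mult_mat_index_sum) auto
  also have "\<dots> = (\<Sum>b<n. \<Sum>a<n. cnj (U $$ (a, i)) * X $$ (a, b) * U $$ (b, j))"
    using U assms by (intro sum.cong)
      (auto simp: mult_mat_index_sum[OF U_adj assms(1)] sum_distrib_right simp del: index_mult_mat(1))
  finally show ?thesis by (subst sum.swap)
qed

lemma of_coords_index:
  assumes "Y \<in> carrier_mat n n" "a < n" "b < n"
  shows "of_coords Y $$ (a, b) = (\<Sum>i<n. \<Sum>j<n. U $$ (a, i) * Y $$ (i, j) * cnj (U $$ (b, j)))"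
proof -
  have "of_coords Y $$ (a, b) = (\<Sum>j<n. (U * Y) $$ (a, j) * mat_adjoint U $$ (j, b))"
    unfolding of_coords_def using U assms by (intro mult_mat_index_sum) auto
  also have "\<dots> = (\<Sum>j<n. \<Sum>i<n. U $$ (a, i) * Y $$ (i, j) * cnj (U $$ (b, j)))"
    using U assms by (intro sum.cong)
      (auto simp: mult_mat_index_sum[OF U assms(1)] sum_distrib_right simp del: index_mult_mat(1))
  finally show ?thesis by (subst sum.swap)
qed

lemma coords_add:
  assumes "X \<in> carrier_mat n n" "Y \<in> carrier_mat n n" "i < n" "j < n"
  shows "coords (X + Y) $$ (i, j) = coords X $$ (i, j) + coords Y $$ (i, j)"
  using assms by (simp add: coords_index algebra_simps sum.distrib)

lemma coords_diff:
  assumes "X \<in> carrier_mat n n" "Y \<in> carrier_mat n n" "i < n" "j < n"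
  shows "coords (X - Y) $$ (i, j) = coords X $$ (i, j) - coords Y $$ (i, j)"
proof -
  have "X - Y \<in> carrier_mat n n" using assms by (simp add: minus_carrier_mat)
  then show ?thesis using assms
    by (simp add: coords_index[OF _ assms(3,4)] algebra_simps sum_subtractf)
qed

lemma coords_smult:
  assumes "X \<in> carrier_mat n n" "i < n" "j < n"
  shows "coords (c \<cdot>\<^sub>m X) $$ (i, j) = c * coords X $$ (i, j)"
  using assms by (simp add: coords_index algebra_simps sum_distrib_left)

lemma coords_mult:
  assumes "X \<in> carrier_mat n n" "Y \<in> carrier_mat n n"
  shows "coords (X * Y) = coords X * coords Y"
proof -
  have "coords X * coords Y = mat_adjoint U * X * (U * mat_adjoint U) * Y * U"
    using U assms by (simp add: coords_def square_simps)
  then show ?thesis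
    using U assms by (simp add: UU' coords_def square_simps)
qed

lemma hs_inner_coords:
  assumes X: "X \<in> carrier_mat n n" and Y: "Y \<in> carrier_mat n n"
  shows "hs_inner X Y = (\<Sum>i<n. \<Sum>j<n. cnj (coords X $$ (i, j)) * coords Y $$ (i, j))"
proof -
  have "mat_adjoint (coords X) = coords (mat_adjoint X)"
    using U X by (simp add: coords_def mat_adjoint_mult[of _ n n _ n] square_simps)
  then have "hs_inner (coords X) (coords Y) = sum_list (diag_mat (mat_adjoint U * (mat_adjoint X * Y) * U))"
    using X Y by (simp add: hs_inner_def flip: coords_mult) (simp add: coords_def)
  also have "\<dots> = sum_list (diag_mat (U * (mat_adjoint U * (mat_adjoint X * Y))))"
    using X Y U by (intro mat_trace_comm) auto
  also have "U * (mat_adjoint U * (mat_adjoint X * Y)) = mat_adjoint X * Y"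
    using X Y U by (simp add: UU' mult_carrier_mat[of _ n n _ n] flip: assoc_mult_mat[of _ n n _ n _ n])
  finally show ?thesis
    using X Y by (simp add: hs_inner_sum[of _ n n] flip: hs_inner_def)
qed

text \<open>
  The Schur (entrywise) product with the symbol \<open>h\<close>, carried out in the basis given by \<open>U\<close>. These
  operators commute and compose by multiplication of symbols.
\<close>

definition multiplier :: "(nat \<Rightarrow> nat \<Rightarrow> complex) \<Rightarrow> complex mat \<Rightarrow> complex mat" where
  "multiplier h X = of_coords (mat n n (\<lambda>(i, j). h i j * coords X $$ (i, j)))"

lemma multiplier_carrier [simp]: "multiplier h X \<in> carrier_mat n n"
  by (simp add: multiplier_def)

lemma multiplier_dim [simp]: "dim_row (multiplier h X) = n" "dim_col (multiplier h X) = n"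
  using multiplier_carrier by blast+

lemma coords_multiplier [simp]:
  assumes "i < n" "j < n"
  shows "coords (multiplier h X) $$ (i, j) = h i j * coords X $$ (i, j)"
  using assms by (simp add: multiplier_def)

lemma multiplier_index:
  assumes "a < n" "b < n"
  shows "multiplier h X $$ (a, b) =
    (\<Sum>i<n. \<Sum>j<n. h i j * (U $$ (a, i) * coords X $$ (i, j) * cnj (U $$ (b, j))))"
  using assms by (simp add: multiplier_def of_coords_index algebra_simps)

lemma linear_op_multiplier:
  assumes "\<And>X. X \<in> carrier_mat n n \<Longrightarrow> T X = multiplier h X"
  shows "linear_op n T"
  unfolding linear_op_def
proof (intro conjI ballI allI)
  fix X Y :: "complex mat" and c :: complex
  assume X: "X \<in> carrier_mat n n"
  then show "T X \<in> carrier_mat n n" by (simp add: assms)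
  show "T (c \<cdot>\<^sub>m X) = c \<cdot>\<^sub>m T X"
    using X by (intro eq_if_coords_eq) (simp_all add: assms coords_smult)
  assume Y: "Y \<in> carrier_mat n n"
  show "T (X + Y) = T X + T Y"
    using X Y by (intro eq_if_coords_eq) (simp_all add: assms coords_add distrib_left)
qed

lemma multiplier_inverse:
  assumes T: "\<And>X. X \<in> carrier_mat n n \<Longrightarrow> T X = multiplier h X"
    and h: "\<And>i j. i < n \<Longrightarrow> j < n \<Longrightarrow> h i j \<noteq> 0"
  shows "bij_betw T (carrier_mat n n) (carrier_mat n n)"
    and "X \<in> carrier_mat n n \<Longrightarrow> inv_op n T X = multiplier (\<lambda>i j. 1 / h i j) X"
proof -
  have right_inv: "T (multiplier (\<lambda>i j. 1 / h i j) X) = X" if "X \<in> carrier_mat n n" for X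
    using that h by (intro eq_if_coords_eq) (simp_all add: T)
  have left_inv: "multiplier (\<lambda>i j. 1 / h i j) (T X) = X" if "X \<in> carrier_mat n n" for X
    using that h by (intro eq_if_coords_eq) (simp_all add: T)
  show bij: "bij_betw T (carrier_mat n n) (carrier_mat n n)"
    by (rule bij_betw_byWitness[where f' = "multiplier (\<lambda>i j. 1 / h i j)"])
      (use right_inv left_inv in \<open>simp_all add: image_subset_iff, simp add: T\<close>)
  show "inv_op n T X = multiplier (\<lambda>i j. 1 / h i j) X" if "X \<in> carrier_mat n n"
    unfolding inv_op_def using bij that right_inv
    by (intro inv_into_f_eq) (auto simp: bij_betw_def)
qed

lemma mult_multiplier:
  assumes D: "D \<in> carrier_mat n n" "coords D = diagonal n d" and X: "X \<in> carrier_mat n n"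
  shows "left_mult D X = multiplier (\<lambda>i j. d i) X"
    and "right_mult D X = multiplier (\<lambda>i j. d j) X"
proof -
  have "coords (D * X) $$ (i, j) = d i * coords X $$ (i, j)" if "i < n" "j < n" for i j
  proof -
    have "coords (D * X) $$ (i, j) = (\<Sum>k<n. diagonal n d $$ (i, k) * coords X $$ (k, j))"
      using D X that by (simp only: coords_mult mult_mat_index_sum[of _ n n _ n] coords_carrier mat_carrier)
    also have "\<dots> = (\<Sum>k<n. if k = i then d i * coords X $$ (i, j) else 0)"
      using that by (intro sum.cong) auto
    finally show ?thesis using that by simp
  qed
  then show "left_mult D X = multiplier (\<lambda>i j. d i) X"
    using D X by (intro eq_if_coords_eq) (simp_all add: left_mult_def)
  have "coords (X * D) $$ (i, j) = d j * coords X $$ (i, j)" if "i < n" "j < n" for i j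
  proof -
    have "coords (X * D) $$ (i, j) = (\<Sum>k<n. coords X $$ (i, k) * diagonal n d $$ (k, j))"
      using D X that by (simp only: coords_mult mult_mat_index_sum[of _ n n _ n] coords_carrier mat_carrier)
    also have "\<dots> = (\<Sum>k<n. if k = j then d j * coords X $$ (i, j) else 0)"
      using that by (intro sum.cong) auto
    finally show ?thesis using that by simp
  qed
  then show "right_mult D X = multiplier (\<lambda>i j. d j) X"
    using D X by (intro eq_if_coords_eq) (simp_all add: right_mult_def)
qed

text \<open>
  The rank one operators formed from two basis vectors: a common orthonormal eigenbasis of all
  multipliers.
\<close>

definition matrix_unit :: "nat \<Rightarrow> nat \<Rightarrow> complex mat" where
  "matrix_unit i j = of_coords (mat n n (\<lambda>p. if p = (i, j) then 1 else 0))"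

lemma matrix_unit_carrier [simp]: "matrix_unit i j \<in> carrier_mat n n"
  by (simp add: matrix_unit_def)

lemma coords_matrix_unit [simp]:
  assumes "k < n" "l < n"
  shows "coords (matrix_unit i j) $$ (k, l) = (if k = i \<and> l = j then 1 else 0)"
  using assms by (simp add: matrix_unit_def)

lemma hs_inner_matrix_unit:
  assumes "X \<in> carrier_mat n n" "i < n" "j < n"
  shows "hs_inner (matrix_unit i j) X = coords X $$ (i, j)"
proof -
  have "hs_inner (matrix_unit i j) X =
      (\<Sum>k<n. \<Sum>l<n. if k = i then (if l = j then coords X $$ (i, j) else 0) else 0)"
    unfolding hs_inner_coords[OF matrix_unit_carrier assms(1)] by (intro sum.cong refl) auto
  also have "\<dots> = (\<Sum>k<n. if k = i then \<Sum>l<n. if l = j then coords X $$ (i, j) else 0 else 0)"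
    by (intro sum.cong refl) simp
  finally show ?thesis using assms by simp
qed

section \<open>Functional calculus of a multiplier\<close>

context
  fixes T :: "complex mat \<Rightarrow> complex mat" and h :: "nat \<Rightarrow> nat \<Rightarrow> real"
  assumes T: "\<And>X. X \<in> carrier_mat n n \<Longrightarrow> T X = multiplier (\<lambda>i j. of_real (h i j)) X"
begin

text \<open>
  A multiplier is diagonal with respect to the matrix units, so its eigenspaces are the
  coordinate subspaces on which the symbol is constant.
\<close>

lemma eigenspace_multiplier_iff:
  "X \<in> eigenspace_op n T r \<longleftrightarrow>
    X \<in> carrier_mat n n \<and> (\<forall>i<n. \<forall>j<n. h i j \<noteq> r \<longrightarrow> coords X $$ (i, j) = 0)"
proof (cases "X \<in> carrier_mat n n")
  case True
  have "T X = complex_of_real r \<cdot>\<^sub>m X \<longleftrightarrow>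
      (\<forall>i<n. \<forall>j<n. of_real (h i j) * coords X $$ (i, j) = of_real r * coords X $$ (i, j))"
  proof
    assume eq: "T X = complex_of_real r \<cdot>\<^sub>m X"
    show "\<forall>i<n. \<forall>j<n. of_real (h i j) * coords X $$ (i, j) = of_real r * coords X $$ (i, j)"
    proof (intro allI impI)
      fix i j assume "i < n" "j < n"
      then show "of_real (h i j) * coords X $$ (i, j) = of_real r * coords X $$ (i, j)"
        using True arg_cong[OF eq, of "\<lambda>Y. coords Y $$ (i, j)"] by (simp add: T coords_smult)
    qed
  next
    assume "\<forall>i<n. \<forall>j<n. of_real (h i j) * coords X $$ (i, j) = of_real r * coords X $$ (i, j)"
    then show "T X = complex_of_real r \<cdot>\<^sub>m X"
      using True by (intro eq_if_coords_eq) (simp_all add: T coords_smult)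
  qed
  then show ?thesis using True by (auto simp: eigenspace_op_def)
qed (simp add: eigenspace_op_def)

lemma real_spectrum_multiplier:
  "real_spectrum_op n T = {r. \<exists>i<n. \<exists>j<n. h i j = r}"
proof (intro Set.set_eqI iffI)
  fix r assume "r \<in> real_spectrum_op n T"
  then obtain X where X: "X \<in> eigenspace_op n T r" "X \<noteq> 0\<^sub>m n n"
    by (auto simp: real_spectrum_op_def)
  show "r \<in> {r. \<exists>i<n. \<exists>j<n. h i j = r}"
  proof (rule ccontr)
    assume "r \<notin> {r. \<exists>i<n. \<exists>j<n. h i j = r}"
    then have "X = 0\<^sub>m n n"
      using X(1) by (intro eq_if_coords_eq) (auto simp: eigenspace_multiplier_iff coords_index[of "0\<^sub>m n n"])
    then show False using X(2) by simp
  qed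
next
  fix r assume "r \<in> {r. \<exists>i<n. \<exists>j<n. h i j = r}"
  then obtain i j where ij: "i < n" "j < n" "h i j = r" by auto
  then have "matrix_unit i j \<in> eigenspace_op n T r"
    by (auto simp: eigenspace_multiplier_iff)
  moreover have "matrix_unit i j \<noteq> 0\<^sub>m n n"
  proof
    assume "matrix_unit i j = 0\<^sub>m n n"
    then have "coords (matrix_unit i j) $$ (i, j) = 0"
      using ij by (simp add: coords_index)
    then show False using ij by simp
  qed
  ultimately show "r \<in> real_spectrum_op n T"
    by (auto simp: real_spectrum_op_def)
qed

text \<open>
  Testing the orthogonality condition against the matrix units in the eigenspace determines the
  coordinates of the projection one by one, which gives uniqueness.
\<close>

lemma orth_proj_multiplier:
  assumes X: "X \<in> carrier_mat n n"
  shows "orth_proj n (eigenspace_op n T r) X = multiplier (\<lambda>i j. of_bool (h i j = r)) X"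
    (is "_ = ?P")
  unfolding orth_proj_def
proof (rule the_equality)
  have "hs_inner Z (X - ?P) = 0" if "Z \<in> eigenspace_op n T r" for Z
    using that X unfolding eigenspace_multiplier_iff
    by (auto simp: hs_inner_coords minus_carrier_mat coords_diff intro!: sum.neutral)
  then show "?P \<in> eigenspace_op n T r \<and> (\<forall>Z\<in>eigenspace_op n T r. hs_inner Z (X - ?P) = 0)"
    by (auto simp: eigenspace_multiplier_iff)
next
  fix Y assume Y: "Y \<in> eigenspace_op n T r \<and> (\<forall>Z\<in>eigenspace_op n T r. hs_inner Z (X - Y) = 0)"
  then have Y_carrier: "Y \<in> carrier_mat n n" by (simp add: eigenspace_multiplier_iff)
  show "Y = ?P"
  proof (rule eq_if_coords_eq[OF Y_carrier])
    fix i j assume ij: "i < n" "j < n"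
    show "coords Y $$ (i, j) = coords ?P $$ (i, j)"
    proof (cases "h i j = r")
      case True
      then have "matrix_unit i j \<in> eigenspace_op n T r"
        using ij by (auto simp: eigenspace_multiplier_iff)
      then have "hs_inner (matrix_unit i j) (X - Y) = 0" using Y by blast
      then have "coords X $$ (i, j) = coords Y $$ (i, j)"
        using X Y_carrier ij by (simp add: hs_inner_matrix_unit minus_carrier_mat coords_diff)
      then show ?thesis using True ij by simp
    next
      case False
      then show ?thesis using Y ij by (simp add: eigenspace_multiplier_iff)
    qed
  qed simp
qed

text \<open>
  The spectral projections select the coordinates by the value of the symbol, so the weighted sum over
  the spectrum contributes to each coordinate exactly once.
\<close>

lemma fun_calc_multiplier:
  assumes X: "X \<in> carrier_mat n n"
  shows "fun_calc n f T X = multiplier (\<lambda>i j. of_real (f (h i j))) X"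
proof (rule eq_matI)
  let ?S = "real_spectrum_op n T"
  let ?m = "\<lambda>a b i j. U $$ (a, i) * coords X $$ (i, j) * cnj (U $$ (b, j))"
  have S: "?S = (\<lambda>(i, j). h i j) ` ({..<n} \<times> {..<n})"
    by (auto simp: real_spectrum_multiplier)
  then have fin: "finite ?S" by simp
  fix a b assume "a < dim_row (multiplier (\<lambda>i j. complex_of_real (f (h i j))) X)"
    "b < dim_col (multiplier (\<lambda>i j. complex_of_real (f (h i j))) X)"
  then have ab: "a < n" "b < n"
    by simp_all
  have "fun_calc n f T X $$ (a, b) =
      (\<Sum>r\<in>?S. of_real (f r) * (\<Sum>i<n. \<Sum>j<n. of_bool (h i j = r) * ?m a b i j))"
    using ab X by (simp add: fun_calc_def orth_proj_multiplier multiplier_index)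
  also have "\<dots> = (\<Sum>i<n. \<Sum>j<n. \<Sum>r\<in>?S. of_real (f r) * (of_bool (h i j = r) * ?m a b i j))"
    by (simp only: sum_distrib_left sum.swap[of _ "{..<n}" ?S])
  also have "\<dots> = (\<Sum>i<n. \<Sum>j<n. of_real (f (h i j)) * ?m a b i j)"
  proof (intro sum.cong refl)
    fix i j assume "i \<in> {..<n}" "j \<in> {..<n}"
    then have "h i j \<in> ?S" by (auto simp: S)
    moreover have "(\<Sum>r\<in>?S. of_real (f r) * (of_bool (h i j = r) * ?m a b i j))
        = (\<Sum>r\<in>?S. if r = h i j then of_real (f (h i j)) * ?m a b i j else 0)"
      by (intro sum.cong) auto
    ultimately show "(\<Sum>r\<in>?S. of_real (f r) * (of_bool (h i j = r) * ?m a b i j))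
        = of_real (f (h i j)) * ?m a b i j"
      using fin by simp
  qed
  finally show "fun_calc n f T X $$ (a, b) = multiplier (\<lambda>i j. of_real (f (h i j))) X $$ (a, b)"
    using ab by (simp add: multiplier_index)
qed (simp_all add: fun_calc_def)

end

text \<open>
  The modular operator of left multiplication and inverse right multiplication has the symbol
  \<open>d i / d j\<close>; the functional calculus applies \<open>f\<close> to it, and the final right multiplication contributes
  the factor \<open>d j\<close>.
\<close>

lemma J_op_multiplier:
  fixes d :: "nat \<Rightarrow> real"
  assumes D: "D \<in> carrier_mat n n" "coords D = diagonal n (\<lambda>i. of_real (d i))"
    and d: "\<And>i. i < n \<Longrightarrow> 0 < d i" and X: "X \<in> carrier_mat n n"
  shows "J_op n f D X = multiplier (\<lambda>i j. of_real (f (d i / d j) * d j)) X"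
proof -
  have inv: "inv_op n (right_mult D) Y = multiplier (\<lambda>i j. 1 / of_real (d j)) Y"
    if "Y \<in> carrier_mat n n" for Y
    using mult_multiplier(2)[OF D] d that by (intro multiplier_inverse(2)) force+
  have modular: "(left_mult D \<circ> inv_op n (right_mult D)) Y = multiplier (\<lambda>i j. of_real (d i / d j)) Y"
    if "Y \<in> carrier_mat n n" for Y
    using that by (intro eq_if_coords_eq) (simp_all add: inv mult_multiplier(1)[OF D])
  have "right_mult D X \<in> carrier_mat n n"
    using X by (simp add: mult_multiplier(2)[OF D])
  then have "J_op n f D X = multiplier (\<lambda>i j. of_real (f (d i / d j))) (right_mult D X)"
    unfolding J_op_def comp_apply[of "fun_calc _ _ _"]
    by (intro fun_calc_multiplier[OF modular])
  also have "\<dots> = multiplier (\<lambda>i j. of_real (f (d i / d j) * d j)) X"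
    using X by (intro eq_if_coords_eq) (simp_all add: mult_multiplier(2)[OF D])
  finally show ?thesis .
qed

section \<open>Complete positivity of multipliers\<close>

text \<open>
  The sesquilinear form of a multiplied matrix, in coordinates: the symbol enters entrywise and the
  vectors are transformed by the adjoint of \<open>U\<close>.
\<close>

lemma multiplier_form:
  "(\<Sum>a<n. \<Sum>b<n. cnj (v a) * multiplier h X $$ (a, b) * w b) =
   (\<Sum>i<n. \<Sum>j<n. h i j * (cnj (\<Sum>a<n. cnj (U $$ (a, i)) * v a) * coords X $$ (i, j)
      * (\<Sum>b<n. cnj (U $$ (b, j)) * w b)))"
proof -
  let ?t = "\<lambda>a b i j. cnj (v a) * (h i j * (U $$ (a, i) * coords X $$ (i, j) * cnj (U $$ (b, j)))) * w b"
  have "(\<Sum>a<n. \<Sum>b<n. cnj (v a) * multiplier h X $$ (a, b) * w b) =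
      (\<Sum>a<n. \<Sum>b<n. \<Sum>i<n. \<Sum>j<n. ?t a b i j)"
    by (intro sum.cong) (simp_all add: multiplier_index sum_distrib_left sum_distrib_right)
  also have "\<dots> = (\<Sum>i<n. \<Sum>j<n. \<Sum>a<n. \<Sum>b<n. ?t a b i j)"
    by (rule sum_swap_pairs)
  also have "\<dots> = (\<Sum>i<n. \<Sum>j<n. h i j * (cnj (\<Sum>a<n. cnj (U $$ (a, i)) * v a) * coords X $$ (i, j)
      * (\<Sum>b<n. cnj (U $$ (b, j)) * w b)))"
    by (intro sum.cong refl) (simp add: sum_distrib_left sum_distrib_right mult_ac)
  finally show ?thesis .
qed

lemma coords_form:
  assumes "X \<in> carrier_mat n n"
  shows "(\<Sum>i<n. \<Sum>j<n. cnj (p i) * coords X $$ (i, j) * q j) =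
    (\<Sum>a<n. \<Sum>b<n. cnj (\<Sum>i<n. U $$ (a, i) * p i) * X $$ (a, b) * (\<Sum>j<n. U $$ (b, j) * q j))"
proof -
  let ?t = "\<lambda>i j a b. cnj (p i) * (cnj (U $$ (a, i)) * X $$ (a, b) * U $$ (b, j)) * q j"
  have "(\<Sum>i<n. \<Sum>j<n. cnj (p i) * coords X $$ (i, j) * q j) =
      (\<Sum>i<n. \<Sum>j<n. \<Sum>a<n. \<Sum>b<n. ?t i j a b)"
    by (intro sum.cong) (simp_all add: coords_index[OF assms] sum_distrib_left sum_distrib_right)
  also have "\<dots> = (\<Sum>a<n. \<Sum>b<n. \<Sum>i<n. \<Sum>j<n. ?t i j a b)"
    by (rule sum_swap_pairs)
  also have "\<dots> = (\<Sum>a<n. \<Sum>b<n. cnj (\<Sum>i<n. U $$ (a, i) * p i) * X $$ (a, b) * (\<Sum>j<n. U $$ (b, j) * q j))"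
    by (intro sum.cong refl) (simp add: sum_distrib_left sum_distrib_right mult_ac)
  finally show ?thesis .
qed

text \<open>
  The quadratic form of the ampliation at a vector \<open>v\<close> equals the sum over \<open>i\<close> and \<open>j\<close> of
  \<open>h i j * N i j\<close>, where \<open>N\<close> collects the \<open>(i, j)\<close> coordinates of all blocks, weighted by the coordinates
  \<open>w k\<close> of the \<open>k\<close>-th segment of \<open>v\<close>. A quadratic form of \<open>N\<close> is a quadratic form of the block
  matrix itself, so \<open>N\<close> is positive semidefinite, and so is its Schur product with \<open>h\<close>. The sum of
  all entries is the value of that form at the constant vector \<open>1\<close>.
\<close>

lemma multiplier_completely_positive:
  assumes T: "\<And>X. X \<in> carrier_mat n n \<Longrightarrow> T X = multiplier h X"
    and h: "\<And>N. psd_kernel {..<n} N \<Longrightarrow> psd_kernel {..<n} (\<lambda>i j. h i j * N i j)"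
  shows "completely_positive n T"
  unfolding completely_positive_def
proof (intro conjI allI impI)
  show "linear_op n T" using T by (rule linear_op_multiplier)
  fix m M assume M: "pos_semidef (m * n) M"
  then have M_carrier: "M \<in> carrier_mat (m * n) (m * n)" by (simp add: pos_semidef_def)
  have amp_carrier: "ampliation m n T M \<in> carrier_mat (m * n) (m * n)"
    by (simp add: ampliation_def)
  have amp_index: "ampliation m n T M $$ (k * n + a, l * n + b) = multiplier h (block n M k l) $$ (a, b)"
    if "k < m" "l < m" "a < n" "b < n" for k l a b
  proof -
    have "k * n + a < m * n" "l * n + b < m * n"
      using that block_index_less by blast+
    then show ?thesis
      using that by (simp add: ampliation_def T block_def)
  qed
  have "0 \<le> (ampliation m n T M *\<^sub>v v) \<bullet>c v" if v: "v \<in> carrier_vec (m * n)" for v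
  proof -
    define w where "w = (\<lambda>k i. \<Sum>a<n. cnj (U $$ (a, i)) * v $ (k * n + a))"
    define N where "N = (\<lambda>i j. \<Sum>k<m. \<Sum>l<m. cnj (w k i) * coords (block n M k l) $$ (i, j) * w l j)"
    have block: "block n M k l \<in> carrier_mat n n" for k l by (simp add: block_def)
    have "psd_kernel {..<n} N"
      unfolding psd_kernel_def
    proof
      fix c
      \<comment> \<open>The test vector for the block matrix: segment \<open>k\<close> has coordinates \<open>w k i * c i\<close>.\<close>
      define y where "y = vec (m * n) (\<lambda>p. \<Sum>i<n. U $$ (p mod n, i) * (w (p div n) i * c i))"
      have y: "y $ (k * n + a) = (\<Sum>i<n. U $$ (a, i) * (w k i * c i))" if "k < m" "a < n" for k a
        using that block_index_less[of k m a n] by (simp add: y_def)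
      have y_carrier: "y \<in> carrier_vec (m * n)" by (simp add: y_def)
      have "(\<Sum>i<n. \<Sum>j<n. cnj (c i) * N i j * c j) =
          (\<Sum>i<n. \<Sum>j<n. \<Sum>k<m. \<Sum>l<m. cnj (w k i * c i) * coords (block n M k l) $$ (i, j) * (w l j * c j))"
        by (simp add: N_def sum_distrib_left sum_distrib_right mult_ac)
      also have "\<dots> = (\<Sum>k<m. \<Sum>l<m. \<Sum>i<n. \<Sum>j<n.
          cnj (w k i * c i) * coords (block n M k l) $$ (i, j) * (w l j * c j))"
        by (rule sum_swap_pairs)
      also have "\<dots> = (\<Sum>k<m. \<Sum>l<m. \<Sum>a<n. \<Sum>b<n.
          cnj (y $ (k * n + a)) * M $$ (k * n + a, l * n + b) * y $ (l * n + b))"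
        unfolding coords_form[OF block] by (intro sum.cong refl) (simp add: y block_def)
      also have "\<dots> = (\<Sum>k<m. \<Sum>a<n. \<Sum>l<m. \<Sum>b<n.
          cnj (y $ (k * n + a)) * M $$ (k * n + a, l * n + b) * y $ (l * n + b))"
        by (rule sum.cong[OF refl], rule sum.swap)
      also have "\<dots> = (M *\<^sub>v y) \<bullet>c y"
        using quadratic_form_sum[OF M_carrier, of y] by (simp add: y_carrier sum_nat_blocks)
      also have "\<dots> \<ge> 0"
        using M by (simp add: pos_semidef_def y_def)
      finally show "0 \<le> (\<Sum>i<n. \<Sum>j<n. cnj (c i) * N i j * c j)" .
    qed
    then have "psd_kernel {..<n} (\<lambda>i j. h i j * N i j)" by (rule h)
    then have "0 \<le> (\<Sum>i<n. \<Sum>j<n. cnj 1 * (h i j * N i j) * 1)"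
      unfolding psd_kernel_def by (rule spec)
    then have "0 \<le> (\<Sum>i<n. \<Sum>j<n. h i j * N i j)" by simp
    also have "(\<Sum>i<n. \<Sum>j<n. h i j * N i j) = (\<Sum>i<n. \<Sum>j<n. \<Sum>k<m. \<Sum>l<m.
        h i j * (cnj (w k i) * coords (block n M k l) $$ (i, j) * w l j))"
      by (simp add: N_def sum_distrib_left)
    also have "\<dots> = (\<Sum>k<m. \<Sum>l<m. \<Sum>i<n. \<Sum>j<n.
        h i j * (cnj (w k i) * coords (block n M k l) $$ (i, j) * w l j))"
      by (rule sum_swap_pairs)
    also have "\<dots> = (\<Sum>k<m. \<Sum>l<m. \<Sum>a<n. \<Sum>b<n.
        cnj (v $ (k * n + a)) * ampliation m n T M $$ (k * n + a, l * n + b) * v $ (l * n + b))"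
      using multiplier_form[of "\<lambda>a. v $ (k * n + a)" h "block n M k l" "\<lambda>b. v $ (l * n + b)" for k l]
      by (simp add: amp_index w_def)
    also have "\<dots> = (\<Sum>k<m. \<Sum>a<n. \<Sum>l<m. \<Sum>b<n.
        cnj (v $ (k * n + a)) * ampliation m n T M $$ (k * n + a, l * n + b) * v $ (l * n + b))"
      by (rule sum.cong[OF refl], rule sum.swap)
    also have "\<dots> = (ampliation m n T M *\<^sub>v v) \<bullet>c v"
      using quadratic_form_sum[OF amp_carrier v] by (simp add: sum_nat_blocks)
    finally show ?thesis .
  qed
  then show "pos_semidef (m * n) (ampliation m n T M)"
    by (simp add: pos_semidef_def ampliation_def)
qed

end

section \<open>Complete positivity of the inverse\<close>

theorem theorem2:
  fixes t :: real and n :: nat and D :: "complex mat"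
  assumes "0 < t" and "t < 1"
    and "n \<ge> 1"
    and "pos_def n D"
  shows "bij_betw (J_op n (f_t t) D) (carrier_mat n n) (carrier_mat n n) \<and>
         completely_positive n (inv_op n (J_op n (f_t t) D))"
proof -
  obtain U and d :: "nat \<Rightarrow> real" where U: "U \<in> carrier_mat n n" "mat_adjoint U * U = 1\<^sub>m n"
    and diag: "mat_adjoint U * D * U = diagonal n (\<lambda>i. of_real (d i))"
    and d: "\<And>i. i < n \<Longrightarrow> 0 < d i"
    using pos_def_diagonalization[OF assms(4)] by blast
  interpret orthonormal_basis n U by unfold_locales (fact U)+
  have D: "D \<in> carrier_mat n n" using assms(4) by (simp add: pos_def_def)
  define h where "h = (\<lambda>i j. complex_of_real (f_t t (d i / d j) * d j))"
  \<comment> \<open>The reciprocal symbol up to the positive constant \<open>t * (1 - t)\<close>.\<close>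
  define K where "K = (\<lambda>i j. divdiff_powr t (d i) (d j) * divdiff_powr (1 - t) (d i) (d j))"
  have J: "J_op n (f_t t) D X = multiplier h X" if "X \<in> carrier_mat n n" for X
    unfolding h_def by (rule J_op_multiplier[OF D _ d that]) (simp add: coords_def diag)
  have recip: "(f_t t (d i / d j) * d j) * K i j = t * (1 - t)" if "i < n" "j < n" for i j
    unfolding K_def using f_t_reciprocal[OF assms(1,2) d[OF that(1)] d[OF that(2)]] .
  have tt: "0 < t * (1 - t)" using assms by simp
  have h_ne: "h i j \<noteq> 0" if "i < n" "j < n" for i j
    using recip[OF that] tt unfolding h_def by auto
  have h_inv: "1 / h i j = of_real (1 / (t * (1 - t))) * of_real (K i j)" if "i < n" "j < n" for i j
  proof -
    have "h i j * of_real (K i j) = of_real (t * (1 - t))"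
      unfolding h_def by (simp only: flip: recip[OF that] of_real_mult)
    moreover have "of_real (t * (1 - t)) \<noteq> (0 :: complex)" using tt by (simp only: of_real_eq_0_iff)
    ultimately show ?thesis using h_ne[OF that] unfolding of_real_divide of_real_1
      by (metis (no_types) divide_eq_eq nonzero_eq_divide_eq mult.commute times_divide_eq_left mult_1)
  qed
  have "completely_positive n (inv_op n (J_op n (f_t t) D))"
  proof (rule multiplier_completely_positive)
    show "inv_op n (J_op n (f_t t) D) X = multiplier (\<lambda>i j. 1 / h i j) X" if "X \<in> carrier_mat n n" for X
      using J h_ne that by (rule multiplier_inverse(2))
    fix N assume N: "psd_kernel {..<n} N"
    have "psd_kernel {..<n} (\<lambda>i j. divdiff_powr t (d i) (d j) *
        (divdiff_powr (1 - t) (d i) (d j) * N i j))"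
      using assms d by (intro psd_kernel_schur_divdiff_powr N) auto
    then have "psd_kernel {..<n} (\<lambda>i j. of_real (1 / (t * (1 - t))) * (divdiff_powr t (d i) (d j) *
        (divdiff_powr (1 - t) (d i) (d j) * N i j)))"
      using tt by (intro psd_kernel_scale) (auto simp: less_eq_complex_def)
    then show "psd_kernel {..<n} (\<lambda>i j. 1 / h i j * N i j)"
      by (rule psd_kernel_cong) (simp add: h_inv K_def mult_ac)
  qed
  then show ?thesis
    using multiplier_inverse(1)[OF J h_ne] by blast
qed

end
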